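(* Let $E$ be a field of characteristic zero with $\operatorname{trdeg}_{\mathbb{Q}}E>0$. Choose a transcendence basis $\mathcal{T}$ of $E/\mathbb{Q}$ and an element $\theta\in\mathcal{T}$. Put $$k_0=\mathbb{Q}(\mathcal{T}\setminus\{\theta\}),\qquad s=\theta^{-1},$$ and let $R$ be the integral closure of $k_0[s]_{(s)}$ in $E$. Then $$P_E=\{0\}\cup\bigcup_{n\in\mathbb{Z}}s^{-n}(\mathbb{Q}_{>0}+sR)$$ is the positive cone of a directed ring order on $E$. It contains $1$ and is closed under inversion of nonzero elements.
   Context: $k_0[s]_{(s)}$ is the localization of $k_0[s]$ at the maximal ideal $(s)$, i.e. $\{f(s)/g(s): f,g\in k_0[X],\ g(0)\neq0\}$. $\mathbb{Q}_{>0}$ is the set of positive rationals. A positive cone in a field $E$ is a subset $P\subseteq E$ with $P+P\subseteq P$, $PP\subseteq P$ and $P\cap(-P)=\{0\}$. It defines a ring order on $E$ by $x\preceq y$ iff $y-x\in P$. The order is directed if every pair of elements has a common upper bound and a common lower bound; equivalently, $P-P=E$. *)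

theory Defs
  imports
    Complex_Main
    "HOL-Computational_Algebra.Polynomial"
    "HOL-Library.Poly_Mapping"
    "HOL-Library.Set_Algebras"
begin

section \<open>Subfields and algebraic elements\<close>

definition is_subfield :: "'a::field set \<Rightarrow> bool" where
  "is_subfield K \<longleftrightarrow> 0 \<in> K \<and> 1 \<in> K \<and>
     (\<forall>x\<in>K. \<forall>y\<in>K. x + y \<in> K \<and> x - y \<in> K \<and> x * y \<in> K) \<and> (\<forall>x\<in>K. inverse x \<in> K)"

text \<open>The subfield \<open>K(S)\<close> generated by \<open>S\<close> over \<open>K\<close>.\<close>

definition field_adjoin :: "'a::field set \<Rightarrow> 'a set \<Rightarrow> 'a set" where
  "field_adjoin K S = is_subfield hull (K \<union> S)"

definition algebraic_over :: "'a::field set \<Rightarrow> 'a \<Rightarrow> bool" where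
  "algebraic_over K x \<longleftrightarrow> (\<exists>p. (\<forall>i. coeff p i \<in> K) \<and> p \<noteq> 0 \<and> poly p x = 0)"

section \<open>Transcendence bases\<close>

text \<open>
  A multivariate polynomial is a finitely supported map from monomials to coefficients, and a
  monomial is a finitely supported map from variables to exponents. The variables are named by
  the field elements that are to be substituted for them, so evaluation takes no assignment.
\<close>

definition mpoly_eval :: "(('a \<Rightarrow>\<^sub>0 nat) \<Rightarrow>\<^sub>0 'a) \<Rightarrow> 'a::field" where
  "mpoly_eval p =
     (\<Sum>m\<in>Poly_Mapping.keys p. Poly_Mapping.lookup p m *
        (\<Prod>x\<in>Poly_Mapping.keys m. x ^ Poly_Mapping.lookup m x))"

definition algebraically_independent :: "'a::field set \<Rightarrow> 'a set \<Rightarrow> bool" where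
  "algebraically_independent K T \<longleftrightarrow>
     (\<forall>p. (\<forall>m\<in>Poly_Mapping.keys p. Poly_Mapping.lookup p m \<in> K \<and> Poly_Mapping.keys m \<subseteq> T) \<and>
          mpoly_eval p = 0 \<longrightarrow> p = 0)"

definition transcendence_basis :: "'a::field set \<Rightarrow> 'a set \<Rightarrow> bool" where
  "transcendence_basis K T \<longleftrightarrow>
     algebraically_independent K T \<and> (\<forall>x. algebraic_over (field_adjoin K T) x)"

text \<open>
  The transcendence degree over \<open>K\<close> of the whole field \<open>'a\<close>, as a cardinal; all transcendence
  bases have the same cardinality.
\<close>

definition trdeg :: "'a::field set \<Rightarrow> 'a rel" where
  "trdeg K = card_of (SOME T. transcendence_basis K T)"

section \<open>Localization and integral closure\<close>

text \<open>
  The localization \<open>k[s]\<^bsub>(s)\<^esub>\<close> inside the ambient field, for \<open>s\<close> transcendental over \<open>k\<close>;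
  then \<open>poly g 0 \<noteq> 0\<close> entails \<open>poly g s \<noteq> 0\<close>, so no division by zero occurs.
\<close>

definition localization_at :: "'a::field set \<Rightarrow> 'a \<Rightarrow> 'a set" where
  "localization_at k s =
     {poly f s / poly g s | f g.
        (\<forall>i. coeff f i \<in> k) \<and> (\<forall>i. coeff g i \<in> k) \<and> poly g 0 \<noteq> 0}"

definition integral_closure :: "'a::field set \<Rightarrow> 'a set" where
  "integral_closure A = {x. \<exists>p. lead_coeff p = 1 \<and> (\<forall>i. coeff p i \<in> A) \<and> poly p x = 0}"

section \<open>Positive cones\<close>

text \<open>\<open>P + P\<close> and \<open>P * P\<close> are the elementwise operations, but unary minus on sets is
  complementation, so the set of negatives is written as an image.\<close>

definition positive_cone :: "'a::field set \<Rightarrow> bool" where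
  "positive_cone P \<longleftrightarrow> P + P \<subseteq> P \<and> P * P \<subseteq> P \<and> P \<inter> uminus ` P = {0}"

definition cone_le :: "'a::field set \<Rightarrow> 'a \<Rightarrow> 'a \<Rightarrow> bool" where
  "cone_le P x y \<longleftrightarrow> y - x \<in> P"

definition directed_order :: "('a \<Rightarrow> 'a \<Rightarrow> bool) \<Rightarrow> bool" where
  "directed_order le \<longleftrightarrow> (\<forall>x y. (\<exists>z. le x z \<and> le y z) \<and> (\<exists>z. le z x \<and> le z y))"

text \<open>Here \<open>a +o B\<close> and \<open>a *o B\<close> are the translate and the dilate of the set \<open>B\<close> by \<open>a\<close>.\<close>

definition cone_of :: "'a::field_char_0 \<Rightarrow> 'a set \<Rightarrow> 'a set" where
  "cone_of s R =
     {0} \<union> (\<Union>n::int. (s powi (- n)) *o (of_rat ` {q. 0 < q} + s *o R))"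

end

theory Submission
  imports Defs "Jordan_Normal_Form.Char_Poly"
begin

text \<open>
  Let \<open>A\<close> be the localization of \<open>k\<^sub>0[s]\<close> at \<open>(s)\<close> and \<open>R\<close> its integral closure in the whole
  field. The cone consists of \<open>0\<close> and the elements \<open>s ^ n * (q + s r)\<close> with an integer \<open>n\<close>, a
  positive rational \<open>q\<close> and \<open>r\<close> in \<open>R\<close>; one should think of \<open>q\<close> as the leading coefficient of a
  Laurent series in \<open>s\<close>. All claims about the cone follow from three properties of \<open>R\<close>
  (\<open>cone_of_directed_division_closed\<close>):

  \<^item> \<open>R\<close> is a ring containing the rational numbers. This needs that sums and products of
    integral elements are integral, which the determinant trick provides
    (\<open>integral_if_stable_module\<close>, \<open>integral_closure_subring\<close>).

  \<^item> \<open>s\<close> is in the Jacobson radical of \<open>R\<close>, so that each \<open>q + s r\<close> is a unit of \<open>R\<close>. For \<open>A\<close>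
    in place of \<open>R\<close> this is clear: adding a multiple of \<open>s\<close> does not change the value at \<open>0\<close> of a
    numerator. It passes from \<open>A\<close> to \<open>R\<close> by reversing an integral equation
    (\<open>in_radical_integral_closure\<close>), without any lying-over theorem for maximal ideals.

  \<^item> Every element of the field becomes integral after multiplication by a power of \<open>s\<close>. Indeed
    it is algebraic over the fraction field of \<open>A\<close>, so some nonzero \<open>a\<close> in \<open>A\<close> makes it
    integral, and \<open>a\<close> is a unit of \<open>A\<close> times a power of \<open>s\<close>
    (\<open>lead_coeff_times_root_integral\<close>, \<open>power_over_nonzero_in_localization\<close>).

  The statements about \<open>A\<close> require that \<open>s\<close> is transcendental over \<open>k\<^sub>0\<close>; this is what the algebraic
  independence of the transcendence basis gives (\<open>algebraically_independent_transcendental\<close>).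
\<close>

section \<open>Subrings and polynomials over them\<close>

definition is_subring :: "'a::comm_ring_1 set \<Rightarrow> bool" where
  "is_subring A \<longleftrightarrow> 1 \<in> A \<and> (\<forall>x\<in>A. \<forall>y\<in>A. x - y \<in> A \<and> x * y \<in> A)"

lemma is_subringI:
  assumes "1 \<in> A" "\<And>x y. x \<in> A \<Longrightarrow> y \<in> A \<Longrightarrow> x - y \<in> A"
    "\<And>x y. x \<in> A \<Longrightarrow> y \<in> A \<Longrightarrow> x * y \<in> A"
  shows "is_subring A"
  using assms unfolding is_subring_def by blast

lemma subring_one: "is_subring A \<Longrightarrow> 1 \<in> A"
  and subring_diff: "is_subring A \<Longrightarrow> x \<in> A \<Longrightarrow> y \<in> A \<Longrightarrow> x - y \<in> A"
  and subring_mult: "is_subring A \<Longrightarrow> x \<in> A \<Longrightarrow> y \<in> A \<Longrightarrow> x * y \<in> A"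
  unfolding is_subring_def by blast+

lemma subring_zero: "is_subring A \<Longrightarrow> 0 \<in> A"
  using subring_diff[of A 1 1] subring_one[of A] by simp

lemma subring_minus: "is_subring A \<Longrightarrow> x \<in> A \<Longrightarrow> - x \<in> A"
  using subring_diff[of A 0 x] subring_zero[of A] by simp

lemma subring_add: "is_subring A \<Longrightarrow> x \<in> A \<Longrightarrow> y \<in> A \<Longrightarrow> x + y \<in> A"
  using subring_diff[of A x "- y"] subring_minus[of A y] by simp

lemma subring_power: "is_subring A \<Longrightarrow> x \<in> A \<Longrightarrow> x ^ n \<in> A"
  by (induction n) (auto intro: subring_one subring_mult)

lemma subring_sum: "is_subring A \<Longrightarrow> (\<And>i. i \<in> I \<Longrightarrow> f i \<in> A) \<Longrightarrow> sum f I \<in> A"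
  by (induction I rule: infinite_finite_induct) (auto intro: subring_zero subring_add)

lemma subring_prod: "is_subring A \<Longrightarrow> (\<And>i. i \<in> I \<Longrightarrow> f i \<in> A) \<Longrightarrow> prod f I \<in> A"
  by (induction I rule: infinite_finite_induct) (auto intro: subring_one subring_mult)

lemmas subring_closed = subring_zero subring_one subring_minus subring_add subring_diff
  subring_mult subring_power subring_sum subring_prod

definition poly_over :: "'a::comm_ring_1 set \<Rightarrow> 'a poly set" where
  "poly_over A = {p. \<forall>i. coeff p i \<in> A}"

lemma poly_over_coeff: "p \<in> poly_over A \<Longrightarrow> coeff p i \<in> A"
  unfolding poly_over_def by blast

lemma pCons_in_poly_over: "is_subring A \<Longrightarrow> a \<in> A \<Longrightarrow> p \<in> poly_over A \<Longrightarrow> pCons a p \<in> poly_over A"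
  unfolding poly_over_def by (auto simp: coeff_pCons split: nat.split)

lemma poly_over_subring: "is_subring A \<Longrightarrow> is_subring (poly_over A)"
  by (rule is_subringI)
    (auto simp: poly_over_def coeff_mult intro: subring_closed)

lemma const_in_poly_over: "is_subring A \<Longrightarrow> a \<in> A \<Longrightarrow> [:a:] \<in> poly_over A"
  by (intro pCons_in_poly_over subring_zero poly_over_subring)

text \<open>
  The entries of \<open>X I - M\<close> are polynomials over \<open>A\<close>, and the Leibniz formula builds the
  determinant from them with ring operations alone.
\<close>

lemma char_poly_in_poly_over:
  fixes M :: "'a::comm_ring_1 mat"
  assumes A: "is_subring A" and M: "M \<in> carrier_mat n n"
    and entries: "\<And>i j. i < n \<Longrightarrow> j < n \<Longrightarrow> M $$ (i, j) \<in> A"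
  shows "char_poly M \<in> poly_over A"
proof -
  note PA = poly_over_subring[OF A]
  have entry: "char_poly_matrix M $$ (i, j) \<in> poly_over A" if "i < n" "j < n" for i j
  proof -
    have "char_poly_matrix M $$ (i, j) = (if i = j then [:0, 1:] else 0) + [:- M $$ (i, j):]"
      using M that by (simp add: char_poly_matrix_def)
    also have "\<dots> \<in> poly_over A"
      using entries[OF that]
      by (auto intro!: PA subring_add const_in_poly_over pCons_in_poly_over
            subring_closed[OF A] subring_zero[OF PA] A)
    finally show ?thesis .
  qed
  have sgn: "signof \<pi> \<in> poly_over A" for \<pi> :: "nat \<Rightarrow> nat"
    by (cases \<pi> rule: sign_cases) (auto intro: subring_closed[OF PA])
  have "char_poly_matrix M \<in> carrier_mat n n" using M by simp
  from det_def'[OF this] show ?thesis unfolding char_poly_def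
    by (auto intro!: subring_sum[OF PA] subring_mult[OF PA] subring_prod[OF PA] sgn entry
        dest: permutes_in_image)
qed

section \<open>Integral closures are rings\<close>

definition span_over :: "'a::comm_ring_1 set \<Rightarrow> 'a set \<Rightarrow> 'a set" where
  "span_over A S = {\<Sum>v\<in>S. c v * v | c. \<forall>v. c v \<in> A}"

lemma span_over_diff:
  assumes "is_subring A" "x \<in> span_over A S" "y \<in> span_over A S"
  shows "x - y \<in> span_over A S"
proof -
  from assms obtain c d where "\<forall>v. c v \<in> A" "x = (\<Sum>v\<in>S. c v * v)"
    "\<forall>v. d v \<in> A" "y = (\<Sum>v\<in>S. d v * v)" unfolding span_over_def by blast
  with assms(1) show ?thesis unfolding span_over_def
    by (auto intro!: exI[of _ "\<lambda>v. c v - d v"] subring_diff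
        simp: sum_subtractf left_diff_distrib)
qed

lemma span_over_scale:
  assumes "is_subring A" "a \<in> A" "x \<in> span_over A S"
  shows "a * x \<in> span_over A S"
proof -
  from assms obtain c where "\<forall>v. c v \<in> A" "x = (\<Sum>v\<in>S. c v * v)"
    unfolding span_over_def by blast
  with assms(1,2) show ?thesis unfolding span_over_def
    by (auto intro!: exI[of _ "\<lambda>v. a * c v"] subring_mult simp: sum_distrib_left mult.assoc)
qed

lemma span_over_zero: "is_subring A \<Longrightarrow> 0 \<in> span_over A S"
  unfolding span_over_def by (auto intro!: exI[of _ "\<lambda>_. 0"] subring_zero)

lemma span_over_sum:
  assumes A: "is_subring A" and f: "\<And>i. i \<in> I \<Longrightarrow> f i \<in> span_over A S"
  shows "sum f I \<in> span_over A S"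
  using f
proof (induction I rule: infinite_finite_induct)
  case (insert i I)
  have "f i - (0 - sum f I) \<in> span_over A S"
    using insert by (intro span_over_diff A span_over_zero) auto
  with insert show ?case by simp
qed (auto intro: span_over_zero A)

lemma span_over_generator:
  assumes "is_subring A" "finite S" "v \<in> S"
  shows "v \<in> span_over A S"
proof -
  have "v = (\<Sum>w\<in>S. (if w = v then 1 else 0) * w)"
    using assms by (simp add: if_distrib[of "\<lambda>c. c * _"] sum.delta cong: if_cong)
  moreover have "(if w = v then 1 else 0) \<in> A" for w
    using assms by (auto intro: subring_closed)
  ultimately show ?thesis unfolding span_over_def
    by (intro CollectI exI[of _ "\<lambda>w. if w = v then 1 else 0"]) blast
qed

lemma span_over_stable:
  assumes A: "is_subring A" and x: "\<And>v. v \<in> S \<Longrightarrow> x * v \<in> span_over A S"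
    and u: "u \<in> span_over A S"
  shows "x * u \<in> span_over A S"
proof -
  from u obtain c where c: "\<forall>v. c v \<in> A" "u = (\<Sum>v\<in>S. c v * v)"
    unfolding span_over_def by blast
  then have "x * u = (\<Sum>v\<in>S. c v * (x * v))" by (simp add: sum_distrib_left ac_simps)
  also have "\<dots> \<in> span_over A S" 
    by (rule span_over_sum[OF A]) (use c x in \<open>auto intro: span_over_scale[OF A]\<close>)
  finally show ?thesis .
qed

text \<open>
  The determinant trick. Multiplication by \<open>z\<close> on the generators \<open>S\<close> is described by a square
  matrix over \<open>A\<close>, and the vector of all generators is an eigenvector of that matrix for the
  eigenvalue \<open>z\<close>; it is not the zero vector because \<open>1\<close> is one of its entries. So \<open>z\<close> is a root
  of the characteristic polynomial, which is monic with coefficients in \<open>A\<close>.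
\<close>

lemma integral_if_stable_module:
  fixes z :: "'a::field"
  assumes A: "is_subring A" and S: "finite S" "1 \<in> S"
    and stable: "\<And>v. v \<in> S \<Longrightarrow> z * v \<in> span_over A S"
  shows "z \<in> integral_closure A"
proof -
  have "\<forall>v\<in>S. \<exists>c. (\<forall>w. c w \<in> A) \<and> z * v = (\<Sum>w\<in>S. c w * w)"
    using stable unfolding span_over_def by blast
  then obtain C where C: "\<And>v w. v \<in> S \<Longrightarrow> C v w \<in> A"
    "\<And>v. v \<in> S \<Longrightarrow> z * v = (\<Sum>w\<in>S. C v w * w)" by metis
  define n where "n = card S"
  obtain b where b: "bij_betw b {0..<n} S"
    using ex_bij_betw_nat_finite[OF S(1)] unfolding n_def by blast
  then have bS: "b i \<in> S" if "i < n" for i using that by (auto simp: bij_betw_def)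
  define M where "M = mat n n (\<lambda>(i, j). C (b i) (b j))"
  have M: "M \<in> carrier_mat n n" unfolding M_def by simp
  have "eigenvector M (vec n b) z"
  proof -
    obtain i where i: "i < n" "b i = 1" using b S(2) by (auto simp: bij_betw_def)
    then have "vec n b \<noteq> 0\<^sub>v n" by (metis index_vec index_zero_vec(1) zero_neq_one)
    moreover have "M *\<^sub>v vec n b = z \<cdot>\<^sub>v vec n b"
    proof (rule eq_vecI)
      fix i assume "i < dim_vec (z \<cdot>\<^sub>v vec n b)"
      then have i: "i < n" by simp
      then have "(M *\<^sub>v vec n b) $ i = (\<Sum>j\<in>{0..<n}. C (b i) (b j) * b j)"
        by (simp add: M_def scalar_prod_def)
      also have "\<dots> = (\<Sum>w\<in>S. C (b i) w * w)"
        by (rule sum.reindex_bij_betw[OF b])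
      also have "\<dots> = z * b i" using C(2)[OF bS[OF i]] by simp
      finally show "(M *\<^sub>v vec n b) $ i = (z \<cdot>\<^sub>v vec n b) $ i" using i by simp
    qed (simp add: M_def)
    ultimately show ?thesis using M unfolding eigenvector_def by auto
  qed
  then have "poly (char_poly M) z = 0"
    using eigenvalue_root_char_poly[OF M] unfolding eigenvalue_def by blast
  moreover have "lead_coeff (char_poly M) = 1" using degree_monic_char_poly[OF M] by simp
  moreover have "char_poly M \<in> poly_over A"
    by (rule char_poly_in_poly_over[OF A M]) (simp add: M_def C(1) bS)
  ultimately show ?thesis unfolding integral_closure_def poly_over_def by blast
qed

text \<open>
  An integral equation solved for its leading term. In this form it can be substituted, scaled
  and produced without determining the degree of a polynomial.
\<close>

lemma integral_closure_iff_power: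
  fixes z :: "'a::field"
  assumes A: "is_subring A"
  shows "z \<in> integral_closure A \<longleftrightarrow>
    (\<exists>n c. (\<forall>i. c i \<in> A) \<and> z ^ n = (\<Sum>i<n. c i * z ^ i))"
proof
  assume "z \<in> integral_closure A"
  then obtain p where p: "lead_coeff p = 1" "\<forall>i. coeff p i \<in> A" "poly p z = 0"
    unfolding integral_closure_def by blast
  from p(3,1) have "z ^ degree p = (\<Sum>i<degree p. (- coeff p i) * z ^ i)"
    unfolding poly_altdef by (simp add: lessThan_Suc_atMost[symmetric] sum_negf eq_neg_iff_add_eq_0 add.commute)
  with p(2) A show "\<exists>n c. (\<forall>i. c i \<in> A) \<and> z ^ n = (\<Sum>i<n. c i * z ^ i)"
    by (intro exI[of _ "degree p"] exI[of _ "\<lambda>i. - coeff p i"]) (auto intro: subring_minus)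
next
  assume "\<exists>n c. (\<forall>i. c i \<in> A) \<and> z ^ n = (\<Sum>i<n. c i * z ^ i)"
  then obtain n c where c: "\<forall>i. c i \<in> A" "z ^ n = (\<Sum>i<n. c i * z ^ i)" by blast
  define p where "p = monom 1 n - (\<Sum>i<n. monom (c i) i)"
  have coeff_p: "coeff p k = (if k = n then 1 else if k < n then - c k else 0)" for k
    unfolding p_def by (simp add: coeff_sum coeff_monom sum.delta)
  have "degree p = n"
    by (intro antisym degree_le le_degree) (auto simp: coeff_p)
  moreover have "poly p z = 0" using c(2) by (simp add: p_def poly_sum poly_monom)
  ultimately show "z \<in> integral_closure A"
    unfolding integral_closure_def using c(1)
    by (auto intro!: exI[of _ p] simp: coeff_p subring_minus[OF A] subring_one[OF A] subring_zero[OF A])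
qed

lemma subset_integral_closure:
  fixes A :: "'a::field set"
  assumes "is_subring A" "a \<in> A"
  shows "a \<in> integral_closure A"
  unfolding integral_closure_iff_power[OF assms(1)]
  using assms(2) by (intro exI[of _ 1] exI[of _ "\<lambda>_. a"]) simp

text \<open>
  Multiplication by \<open>x\<close> raises the exponent of \<open>x\<close> by one. If this leaves the permitted range,
  the integral equation rewrites \<open>x ^ m\<close> in terms of lower powers.
\<close>

lemma power_products_stable:
  fixes x :: "'a::field"
  assumes A: "is_subring A" and c: "\<And>i. c i \<in> A" "x ^ m = (\<Sum>i<m. c i * x ^ i)"
    and S: "S = {x ^ i * y | i y. i < m \<and> y \<in> Y}" "finite S" and v: "v \<in> S"
  shows "x * v \<in> span_over A S"
proof -
  from v obtain i y where iy: "i < m" "y \<in> Y" "v = x ^ i * y" unfolding S(1) by blast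
  show ?thesis
  proof (cases "Suc i < m")
    case True
    then have "x ^ Suc i * y \<in> S" using iy unfolding S(1) by blast
    then show ?thesis using span_over_generator[OF A S(2)] iy by (simp add: mult.assoc)
  next
    case False
    then have "m = Suc i" using iy by simp
    then have "x * v = x ^ m * y" using iy by simp
    also have "\<dots> = (\<Sum>k<m. c k * (x ^ k * y))"
      unfolding c(2) by (simp add: sum_distrib_right mult.assoc)
    also have "\<dots> \<in> span_over A S"
      by (intro span_over_sum span_over_scale A c(1) span_over_generator S(2))
        (use iy(2) in \<open>auto simp: S(1)\<close>)
    finally show ?thesis .
  qed
qed

text \<open>
  If \<open>x\<close> and \<open>y\<close> satisfy monic equations of degrees \<open>m\<close> and \<open>n\<close>, then the span of the products
  \<open>x ^ i * y ^ j\<close> with \<open>i < m\<close> and \<open>j < n\<close> is stable under multiplication by \<open>x\<close> and by \<open>y\<close>,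
  hence under multiplication by \<open>x - y\<close> and \<open>x * y\<close>, and the determinant trick applies to these.
\<close>

theorem integral_closure_subring:
  fixes A :: "'a::field set"
  assumes A: "is_subring A"
  shows "is_subring (integral_closure A)"
proof (rule is_subringI)
  show "1 \<in> integral_closure A" by (intro subset_integral_closure A subring_one)
next
  fix x y assume "x \<in> integral_closure A" "y \<in> integral_closure A"
  then obtain m n c d where c: "\<And>i. c i \<in> A" "x ^ m = (\<Sum>i<m. c i * x ^ i)"
    and d: "\<And>i. d i \<in> A" "y ^ n = (\<Sum>i<n. d i * y ^ i)"
    unfolding integral_closure_iff_power[OF A] by blast
  define S where "S = {x ^ i * y ^ j | i j. i < m \<and> j < n}"
  \<comment> \<open>In degree zero the equation would read \<open>1 = 0\<close>.\<close>
  have "m \<noteq> 0" "n \<noteq> 0" using c(2) d(2) by (auto intro!: Nat.gr0I)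
  then have "x ^ 0 * y ^ 0 \<in> S" unfolding S_def by blast
  then have one: "1 \<in> S" by simp
  have "S = (\<lambda>(i, j). x ^ i * y ^ j) ` ({..<m} \<times> {..<n})" unfolding S_def by auto
  then have fin: "finite S" by simp
  have Sx: "S = {x ^ i * w | i w. i < m \<and> w \<in> (\<lambda>j. y ^ j) ` {..<n}}"
    unfolding S_def by blast
  have Sy: "S = {y ^ i * w | i w. i < n \<and> w \<in> (\<lambda>j. x ^ j) ` {..<m}}"
    unfolding S_def by (auto simp: mult.commute)
  have stx: "x * v \<in> span_over A S" if "v \<in> S" for v
    by (rule power_products_stable[OF A c Sx fin that])
  have sty: "y * v \<in> span_over A S" if "v \<in> S" for v
    by (rule power_products_stable[OF A d Sy fin that])
  show "x - y \<in> integral_closure A"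
    by (rule integral_if_stable_module[OF A fin one])
      (simp add: left_diff_distrib span_over_diff A stx sty)
  show "x * y \<in> integral_closure A"
    by (rule integral_if_stable_module[OF A fin one])
      (simp add: mult.assoc span_over_stable A stx sty)
qed

text \<open>
  Multiplying the equation \<open>p(x) = 0\<close> of degree \<open>n\<close> with leading coefficient \<open>a\<close> by
  \<open>a ^ (n - 1)\<close> turns it into a monic equation for \<open>a * x\<close>.
\<close>

lemma lead_coeff_times_root_integral:
  fixes p :: "'a::field poly"
  assumes A: "is_subring A" and p: "p \<in> poly_over A" "p \<noteq> 0" "poly p x = 0"
  shows "lead_coeff p * x \<in> integral_closure A"
proof -
  define n a where "n = degree p" and "a = lead_coeff p"
  have "n \<noteq> 0"
  proof
    assume "n = 0"
    then obtain b where "p = [:b:]" unfolding n_def by (metis degree_eq_zeroE)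
    then show False using p by auto
  qed
  then obtain k where k: "n = Suc k" using not0_implies_Suc by blast
  have "a * x ^ n = - (\<Sum>i<n. coeff p i * x ^ i)"
    using p(3) unfolding poly_altdef n_def a_def
    by (simp add: lessThan_Suc_atMost[symmetric] eq_neg_iff_add_eq_0 add.commute)
  then have "(a * x) ^ n = a ^ k * - (\<Sum>i<n. coeff p i * x ^ i)"
    by (simp add: k power_mult_distrib mult.assoc mult.left_commute)
  also have "\<dots> = (\<Sum>i<n. - (coeff p i * a ^ (k - i)) * (a * x) ^ i)"
  proof -
    have "a ^ k * (coeff p i * x ^ i) = coeff p i * a ^ (k - i) * (a * x) ^ i" if "i < n" for i
    proof -
      have "a ^ k = a ^ (k - i) * a ^ i" using that k by (simp add: power_add[symmetric])
      then show ?thesis by (simp add: power_mult_distrib)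
    qed
    then have "(\<Sum>i<n. a ^ k * (coeff p i * x ^ i)) = (\<Sum>i<n. coeff p i * a ^ (k - i) * (a * x) ^ i)"
      by (intro sum.cong) auto
    then show ?thesis by (simp add: sum_distrib_left sum_negf)
  qed
  finally have "(a * x) ^ n = (\<Sum>i<n. - (coeff p i * a ^ (k - i)) * (a * x) ^ i)" .
  moreover have "- (coeff p i * a ^ (k - i)) \<in> A" for i
    unfolding a_def by (intro subring_closed[OF A] poly_over_coeff[OF p(1)])
  ultimately show ?thesis
    unfolding integral_closure_iff_power[OF A] a_def[symmetric]
    by (intro exI[of _ n] exI[of _ "\<lambda>i. - (coeff p i * a ^ (k - i))"]) blast
qed

section \<open>The Jacobson radical and integral extensions\<close>

text \<open>
  For an element of a subring, being in the Jacobson radical means that \<open>1 + s b\<close> is a unit for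
  every \<open>b\<close> in the subring. This form avoids maximal ideals.
\<close>

definition in_radical :: "'a::field \<Rightarrow> 'a set \<Rightarrow> bool" where
  "in_radical s A \<longleftrightarrow> s \<in> A \<and> (\<forall>b\<in>A. 1 + s * b \<noteq> 0 \<and> inverse (1 + s * b) \<in> A)"

lemma reflect_poly_in_poly_over: "is_subring A \<Longrightarrow> p \<in> poly_over A \<Longrightarrow> reflect_poly p \<in> poly_over A"
  unfolding poly_over_def by (auto simp: coeff_reflect_poly intro: subring_zero)

text \<open>
  An integral element \<open>r\<close> satisfies a monic equation, which yields one for \<open>s r\<close> in which all
  lower coefficients are multiples of \<open>s\<close>. Substituting \<open>X - 1\<close> gives a polynomial \<open>G\<close> with
  root \<open>u = 1 + s r\<close> and constant coefficient congruent to \<open>\<plusminus>1\<close> modulo \<open>s\<close>, that is, a unit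
  of \<open>A\<close>. Therefore \<open>u\<close> is not zero, and the reversed polynomial, whose leading coefficient is
  that unit, shows that the inverse of \<open>u\<close> is integral.
\<close>

theorem in_radical_integral_closure:
  assumes A: "is_subring A" and s: "in_radical s A"
  shows "in_radical s (integral_closure A)"
proof -
  note RA = integral_closure_subring[OF A]
  have sA: "s \<in> A" using s unfolding in_radical_def by blast
  have "1 + s * r \<noteq> 0 \<and> inverse (1 + s * r) \<in> integral_closure A"
    if "r \<in> integral_closure A" for r
  proof -
    from that obtain n c where c: "\<And>i. c i \<in> A" "r ^ n = (\<Sum>i<n. c i * r ^ i)"
      unfolding integral_closure_iff_power[OF A] by blast
    define u where "u = 1 + s * r"
    define G where "G = [:-1, 1:] ^ n - (\<Sum>i<n. [:c i * s ^ (n - i):] * [:-1, 1:] ^ i)"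
    have G: "G \<in> poly_over A"
      unfolding G_def
      by (intro subring_closed poly_over_subring A const_in_poly_over pCons_in_poly_over c sA)
    have "(s * r) ^ n = (\<Sum>i<n. c i * s ^ (n - i) * (s * r) ^ i)"
    proof -
      have "s ^ n * (c i * r ^ i) = c i * s ^ (n - i) * (s * r) ^ i" if "i < n" for i
      proof -
        have "s ^ n = s ^ (n - i) * s ^ i" using that by (simp add: power_add[symmetric])
        then show ?thesis by (simp add: power_mult_distrib)
      qed
      then have "(\<Sum>i<n. s ^ n * (c i * r ^ i)) = (\<Sum>i<n. c i * s ^ (n - i) * (s * r) ^ i)"
        by (intro sum.cong) auto
      then show ?thesis by (simp add: power_mult_distrib c(2) sum_distrib_left)
    qed
    then have Gu: "poly G u = 0" by (simp add: G_def u_def poly_sum poly_power)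
    \<comment> \<open>The sign \<open>(-1) ^ (i + n)\<close> lets \<open>(-1) ^ n\<close> be factored out of \<open>poly G 0\<close>, and \<open>n - Suc i\<close> leaves
      one factor \<open>s\<close> of \<open>s ^ (n - i)\<close> for \<open>1 + s * b\<close>.\<close>
    define b where "b = - (\<Sum>i<n. c i * s ^ (n - Suc i) * (-1) ^ (i + n))"
    have bA: "b \<in> A" unfolding b_def by (intro subring_closed A c sA)
    have G0: "poly G 0 = (-1) ^ n * (1 + s * b)"
    proof -
      have "c i * s ^ (n - i) * (-1) ^ i = (-1) ^ n * (s * (c i * s ^ (n - Suc i) * (-1) ^ (i + n)))"
        if "i < n" for i
      proof -
        have "s ^ (n - i) = s * s ^ (n - Suc i)"
          using that by (metis Suc_diff_Suc power_Suc)
        moreover have "(-1::'a) ^ n * (-1) ^ (i + n) = (-1) ^ i"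
          by (simp add: power_add flip: power_mult_distrib)
        ultimately show ?thesis by (simp add: mult.left_commute)
      qed
      then have "(\<Sum>i<n. c i * s ^ (n - i) * (-1) ^ i) =
          (\<Sum>i<n. (-1) ^ n * (s * (c i * s ^ (n - Suc i) * (-1) ^ (i + n))))"
        by (intro sum.cong) auto
      then show ?thesis
        by (simp add: G_def b_def poly_sum poly_power right_diff_distrib sum_distrib_left)
    qed
    have unit: "1 + s * b \<noteq> 0" "inverse (1 + s * b) \<in> A"
      using s bA unfolding in_radical_def by auto
    have G0_nz: "poly G 0 \<noteq> 0" using G0 unit(1) by simp
    then have u_nz: "u \<noteq> 0" using Gu by auto
    let ?H = "reflect_poly G"
    have "G \<noteq> 0" using G0_nz by auto
    moreover have "poly ?H (inverse u) = 0"
      using poly_reflect_poly_nz[of "inverse u" G] u_nz Gu by simp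
    ultimately have "lead_coeff ?H * inverse u \<in> integral_closure A"
      by (intro lead_coeff_times_root_integral A reflect_poly_in_poly_over G) simp_all
    moreover have "lead_coeff ?H = poly G 0"
      using G0_nz by (simp add: coeff_reflect_poly poly_0_coeff_0)
    ultimately have "poly G 0 * inverse u \<in> integral_closure A" by simp
    moreover have "inverse (poly G 0) \<in> integral_closure A"
      unfolding G0 by (auto simp: inverse_mult_distrib power_inverse[symmetric]
          intro!: subset_integral_closure A subring_mult subring_power subring_minus
            subring_one unit(2))
    ultimately have "inverse (poly G 0) * (poly G 0 * inverse u) \<in> integral_closure A"
      by (rule subring_mult[OF RA, rotated])
    then have "inverse u \<in> integral_closure A" using G0_nz by (simp flip: mult.assoc)
    then show ?thesis using u_nz unfolding u_def by blast
  qed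
  then show ?thesis unfolding in_radical_def using subset_integral_closure[OF A sA] by blast
qed

section \<open>Fractions and denominators\<close>

definition quotients :: "'a::field set \<Rightarrow> 'a set" where
  "quotients A = {a / b | a b. a \<in> A \<and> b \<in> A \<and> b \<noteq> 0}"

lemma quotientsI: "a \<in> A \<Longrightarrow> b \<in> A \<Longrightarrow> b \<noteq> 0 \<Longrightarrow> a / b \<in> quotients A"
  unfolding quotients_def by blast

lemma quotientsE:
  assumes "x \<in> quotients A"
  obtains a b where "a \<in> A" "b \<in> A" "b \<noteq> 0" "x = a / b"
  using assms unfolding quotients_def by blast

lemma subset_quotients: "is_subring A \<Longrightarrow> A \<subseteq> quotients A"
  using quotientsI[of _ A 1] subring_one by fastforce

lemma quotients_subfield:
  assumes A: "is_subring A"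
  shows "is_subfield (quotients A)"
proof -
  have "x + y \<in> quotients A \<and> x - y \<in> quotients A \<and> x * y \<in> quotients A"
    if "x \<in> quotients A" "y \<in> quotients A" for x y
  proof -
    from that obtain a b c d where ab: "a \<in> A" "b \<in> A" "b \<noteq> 0" "x = a / b"
      and cd: "c \<in> A" "d \<in> A" "d \<noteq> 0" "y = c / d" by (metis quotientsE)
    then have eq: "x + y = (a * d + c * b) / (b * d)" "x - y = (a * d - c * b) / (b * d)"
      "x * y = (a * c) / (b * d)" by (simp_all add: field_simps)
    show ?thesis unfolding eq
      using ab cd A by (auto intro!: quotientsI subring_mult subring_add subring_diff)
  qed
  moreover have "inverse x \<in> quotients A" if x: "x \<in> quotients A" for x
  proof -
    from x obtain a b where ab: "a \<in> A" "b \<in> A" "b \<noteq> 0" "x = a / b" by (rule quotientsE)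
    show ?thesis
    proof (cases "a = 0")
      case True
      then show ?thesis using x ab by simp
    next
      case False
      then show ?thesis using ab quotientsI[of b A a] by simp
    qed
  qed
  moreover have "0 \<in> quotients A" "1 \<in> quotients A"
    using subset_quotients[OF A] subring_zero[OF A] subring_one[OF A] by auto
  ultimately show ?thesis unfolding is_subfield_def by blast
qed

lemma clear_denominators:
  assumes A: "is_subring A" and p: "p \<in> poly_over (quotients A)"
  shows "\<exists>d\<in>A. d \<noteq> 0 \<and> Polynomial.smult d p \<in> poly_over A"
  using p
proof (induction p)
  case 0
  show ?case using subring_one[OF A] subring_zero[OF A] by (auto simp: poly_over_def intro!: bexI[of _ 1])
next
  case (pCons c p)
  have "p \<in> poly_over (quotients A)"
    unfolding poly_over_def using poly_over_coeff[OF pCons.prems, of "Suc _"] by simp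
  then obtain d where d: "d \<in> A" "d \<noteq> 0" "Polynomial.smult d p \<in> poly_over A" using pCons.IH by blast
  from poly_over_coeff[OF pCons.prems, of 0] obtain a b
    where ab: "a \<in> A" "b \<in> A" "b \<noteq> 0" "c = a / b" by (auto elim: quotientsE)
  have "Polynomial.smult (b * d) (pCons c p) = pCons (a * d) ([:b:] * Polynomial.smult d p)"
    using ab by (simp add: mult.commute)
  also have "\<dots> \<in> poly_over A"
    by (intro pCons_in_poly_over subring_mult[OF poly_over_subring[OF A]] const_in_poly_over
        subring_mult[OF A] A ab d)
  finally show ?case using ab d subring_mult[OF A] by (intro bexI[of _ "b * d"]) auto
qed

lemma algebraic_over_quotients_clear:
  assumes A: "is_subring A" and K: "K \<subseteq> quotients A" and x: "algebraic_over K x"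
  shows "\<exists>p\<in>poly_over A. p \<noteq> 0 \<and> poly p x = 0"
proof -
  from x K obtain p where p: "p \<in> poly_over (quotients A)" "p \<noteq> 0" "poly p x = 0"
    unfolding algebraic_over_def poly_over_def by blast
  from clear_denominators[OF A p(1)] obtain d where "d \<noteq> 0" "Polynomial.smult d p \<in> poly_over A" by blast
  with p(2,3) show ?thesis by (intro bexI[of _ "Polynomial.smult d p"]) auto
qed

lemma subfield_subring: "is_subfield K \<Longrightarrow> is_subring K"
  unfolding is_subfield_def is_subring_def by blast

lemma field_adjoin_subfield: "is_subfield (field_adjoin K S)"
  unfolding field_adjoin_def by (rule hull_in) (auto simp: is_subfield_def)

lemma subset_field_adjoin: "K \<subseteq> field_adjoin K S" "S \<subseteq> field_adjoin K S"
  unfolding field_adjoin_def using hull_subset[of "K \<union> S" is_subfield] by auto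

lemma field_adjoin_minimal: "K \<subseteq> F \<Longrightarrow> S \<subseteq> F \<Longrightarrow> is_subfield F \<Longrightarrow> field_adjoin K S \<subseteq> F"
  unfolding field_adjoin_def by (rule hull_minimal) auto

text \<open>
  Reversing the coefficients of a polynomial inverts its nonzero roots.
\<close>

lemma algebraic_over_inverse:
  assumes K: "is_subring K" and x: "algebraic_over K x"
  shows "algebraic_over K (inverse x)"
proof (cases "x = 0")
  case False
  from x obtain p where p: "p \<in> poly_over K" "p \<noteq> 0" "poly p x = 0"
    unfolding algebraic_over_def poly_over_def by blast
  then have "poly (reflect_poly p) (inverse x) = 0"
    using False by (simp add: poly_reflect_poly_nz)
  with p(1,2) reflect_poly_in_poly_over[OF K p(1)] show ?thesis
    unfolding algebraic_over_def poly_over_def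
    by (intro exI[of _ "reflect_poly p"]) auto
next
  case True
  with x show ?thesis by simp
qed

section \<open>The localization of a polynomial ring at its variable\<close>

context
  fixes k :: "'a::field set" and s :: 'a
  assumes k: "is_subfield k" and transcendental: "\<not> algebraic_over k s"
begin

lemma poly_at_transcendental: "g \<in> poly_over k \<Longrightarrow> g \<noteq> 0 \<Longrightarrow> poly g s \<noteq> 0"
  using transcendental unfolding algebraic_over_def poly_over_def by blast

lemma X_in_poly_over: "[:0, 1:] \<in> poly_over k"
  by (intro pCons_in_poly_over const_in_poly_over subring_closed subfield_subring[OF k])

lemma transcendental_nonzero: "s \<noteq> 0"
  using poly_at_transcendental[OF X_in_poly_over] by simp

lemma localization_atI:
  "f \<in> poly_over k \<Longrightarrow> g \<in> poly_over k \<Longrightarrow> poly g 0 \<noteq> 0 \<Longrightarrow> poly f s / poly g s \<in> localization_at k s"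
  unfolding localization_at_def poly_over_def by blast

lemma localization_atE:
  assumes "x \<in> localization_at k s"
  obtains f g where "f \<in> poly_over k" "g \<in> poly_over k" "poly g 0 \<noteq> 0" "poly g s \<noteq> 0"
    "x = poly f s / poly g s"
proof -
  from assms obtain f g where fg: "f \<in> poly_over k" "g \<in> poly_over k" "poly g 0 \<noteq> 0"
    "x = poly f s / poly g s"
    unfolding localization_at_def poly_over_def by blast
  moreover have "poly g s \<noteq> 0" using poly_at_transcendental fg by force
  ultimately show ?thesis using that by blast
qed

lemma localization_at_subring: "is_subring (localization_at k s)"
proof (rule is_subringI)
  note PK = poly_over_subring[OF subfield_subring[OF k]]
  show "1 \<in> localization_at k s"
    using localization_atI[of 1 1] subring_one[OF PK] by simp
  fix x y assume "x \<in> localization_at k s" "y \<in> localization_at k s"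
  then obtain f g f' g' where fg: "f \<in> poly_over k" "g \<in> poly_over k" "poly g 0 \<noteq> 0" "poly g s \<noteq> 0"
    "x = poly f s / poly g s"
    and fg': "f' \<in> poly_over k" "g' \<in> poly_over k" "poly g' 0 \<noteq> 0" "poly g' s \<noteq> 0"
    "y = poly f' s / poly g' s" by (metis localization_atE)
  have "x - y = poly (f * g' - f' * g) s / poly (g * g') s"
    "x * y = poly (f * f') s / poly (g * g') s" unfolding fg(5) fg'(5) using fg(4) fg'(4) by (simp_all add: field_simps)
  moreover have "f * g' - f' * g \<in> poly_over k" "f * f' \<in> poly_over k" "g * g' \<in> poly_over k"
    using fg fg' by (auto intro!: subring_diff subring_mult PK)
  moreover have "poly (g * g') 0 \<noteq> 0" using fg fg' by simp
  ultimately show "x - y \<in> localization_at k s" "x * y \<in> localization_at k s"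
    by (metis localization_atI)+
qed

lemma poly_value_in_localization:
  "f \<in> poly_over k \<Longrightarrow> poly f s \<in> localization_at k s"
  using localization_atI[of f 1] subring_one[OF poly_over_subring[OF subfield_subring[OF k]]] by simp

lemma constants_in_localization: "k \<subseteq> localization_at k s"
  using poly_value_in_localization[OF const_in_poly_over[OF subfield_subring[OF k]]] by auto

lemma in_radical_localization: "in_radical s (localization_at k s)"
  unfolding in_radical_def
proof (intro conjI ballI)
  note PK = poly_over_subring[OF subfield_subring[OF k]]
  show "s \<in> localization_at k s" using poly_value_in_localization[OF X_in_poly_over] by simp
  fix b assume "b \<in> localization_at k s"
  then obtain f g where fg: "f \<in> poly_over k" "g \<in> poly_over k" "poly g 0 \<noteq> 0" "poly g s \<noteq> 0"
    "b = poly f s / poly g s" by (rule localization_atE)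
  define h where "h = g + [:0, 1:] * f"
  have h: "h \<in> poly_over k" unfolding h_def by (intro subring_add subring_mult PK X_in_poly_over fg)
  have h0: "poly h 0 \<noteq> 0" using fg by (simp add: h_def)
  then have "h \<noteq> 0" by auto
  then have "poly h s \<noteq> 0" by (rule poly_at_transcendental[OF h])
  moreover have eq: "1 + s * b = poly h s / poly g s" using fg by (simp add: h_def field_simps)
  ultimately show "1 + s * b \<noteq> 0" using fg by simp
  show "inverse (1 + s * b) \<in> localization_at k s"
    unfolding eq using localization_atI[OF fg(2) h h0] by simp
qed

text \<open>
  Up to units, every nonzero element of the localization is a power of \<open>s\<close>: the exponent is the
  multiplicity of the root \<open>0\<close> in the numerator.
\<close>

lemma power_over_nonzero_in_localization:
  assumes a: "a \<in> localization_at k s" "a \<noteq> 0"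
  shows "\<exists>N. s ^ N * inverse a \<in> localization_at k s"
proof -
  from a(1) obtain f g where fg: "f \<in> poly_over k" "g \<in> poly_over k" "poly g 0 \<noteq> 0" "poly g s \<noteq> 0"
    "a = poly f s / poly g s" by (rule localization_atE)
  then have "f \<noteq> 0" using a(2) by auto
  from order_decomp[OF this, of 0] obtain h where
    h: "f = [:0, 1:] ^ order 0 f * h" "\<not> [:0, 1:] dvd h" by auto
  define N where "N = order 0 f"
  have "f = monom 1 N * h" using h(1) by (simp add: monom_altdef N_def)
  then have "coeff h i = coeff f (i + N)" for i by (simp add: coeff_monom_mult)
  then have hk: "h \<in> poly_over k" using fg(1) unfolding poly_over_def by simp
  have h0: "poly h 0 \<noteq> 0" using h(2) by (simp add: poly_eq_0_iff_dvd)
  have "poly f s = s ^ N * poly h s"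
    using \<open>f = monom 1 N * h\<close> by (simp add: poly_monom)
  then have "s ^ N * inverse a = poly g s / poly h s"
    using fg(5) transcendental_nonzero by simp
  then show ?thesis using localization_atI[OF fg(2) hk h0] by metis
qed

end

text \<open>
  Some nonzero multiple \<open>a x\<close> of an algebraic element is integral. If \<open>A\<close> contains a quotient
  of a power of \<open>s\<close> by \<open>a\<close>, the factor \<open>a\<close> can be exchanged for that power.
\<close>

lemma power_multiple_integral:
  fixes x :: "'a::field"
  assumes A: "is_subring A" and K: "K \<subseteq> quotients A" and x: "algebraic_over K x"
    and pow: "\<And>a. a \<in> A \<Longrightarrow> a \<noteq> 0 \<Longrightarrow> \<exists>N. s ^ N * inverse a \<in> A"
  shows "\<exists>N. s ^ N * x \<in> integral_closure A"
proof -
  obtain p where p: "p \<in> poly_over A" "p \<noteq> 0" "poly p x = 0"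
    using algebraic_over_quotients_clear[OF A K x] by blast
  define a where "a = lead_coeff p"
  have a: "a \<in> A" "a \<noteq> 0" using p by (auto simp: a_def poly_over_coeff)
  obtain N where N: "s ^ N * inverse a \<in> A" using pow[OF a] by blast
  have "(s ^ N * inverse a) * (a * x) \<in> integral_closure A"
    unfolding a_def
    by (intro subring_mult integral_closure_subring A subset_integral_closure
        lead_coeff_times_root_integral p N[unfolded a_def])
  moreover have "(s ^ N * inverse a) * (a * x) = s ^ N * x" using a(2) by simp
  ultimately show ?thesis by metis
qed

section \<open>Evaluation of multivariate polynomials\<close>

abbreviation monomial_eval :: "('a::field \<Rightarrow>\<^sub>0 nat) \<Rightarrow> 'a" where
  "monomial_eval m \<equiv> \<Prod>x\<in>Poly_Mapping.keys m. x ^ Poly_Mapping.lookup m x"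

lemma monomial_eval_add: "monomial_eval (m + n) = monomial_eval m * monomial_eval n"
proof -
  let ?S = "Poly_Mapping.keys m \<union> Poly_Mapping.keys n"
  have superset: "monomial_eval l = (\<Prod>x\<in>?S. x ^ Poly_Mapping.lookup l x)"
    if "Poly_Mapping.keys l \<subseteq> ?S" for l
    using that by (intro prod.mono_neutral_left) (auto simp: in_keys_iff)
  have "monomial_eval (m + n) = (\<Prod>x\<in>?S. x ^ Poly_Mapping.lookup (m + n) x)"
    by (rule superset[OF keys_add])
  also have "\<dots> = (\<Prod>x\<in>?S. x ^ Poly_Mapping.lookup m x) * (\<Prod>x\<in>?S. x ^ Poly_Mapping.lookup n x)"
    by (simp add: lookup_add power_add prod.distrib)
  finally show ?thesis unfolding superset[OF Un_upper1, symmetric] superset[OF Un_upper2, symmetric] .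
qed

lemma mpoly_eval_add: "mpoly_eval (p + q) = mpoly_eval p + mpoly_eval q"
proof -
  let ?S = "Poly_Mapping.keys p \<union> Poly_Mapping.keys q"
  have superset: "mpoly_eval l = (\<Sum>m\<in>?S. Poly_Mapping.lookup l m * monomial_eval m)"
    if "Poly_Mapping.keys l \<subseteq> ?S" for l
    unfolding mpoly_eval_def using that
    by (intro sum.mono_neutral_left) (auto simp: in_keys_iff)
  have "mpoly_eval (p + q) = (\<Sum>m\<in>?S. Poly_Mapping.lookup (p + q) m * monomial_eval m)"
    by (rule superset[OF keys_add])
  also have "\<dots> = (\<Sum>m\<in>?S. Poly_Mapping.lookup p m * monomial_eval m) +
      (\<Sum>m\<in>?S. Poly_Mapping.lookup q m * monomial_eval m)"
    by (simp add: lookup_add distrib_right sum.distrib)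
  finally show ?thesis unfolding superset[OF Un_upper1, symmetric] superset[OF Un_upper2, symmetric] .
qed

lemma mpoly_eval_zero: "mpoly_eval 0 = 0"
  by (simp add: mpoly_eval_def)

lemma mpoly_eval_diff: "mpoly_eval (p - q) = mpoly_eval p - mpoly_eval q"
  using mpoly_eval_add[of "p - q" q] by simp

lemma mpoly_eval_sum: "mpoly_eval (sum f I) = (\<Sum>i\<in>I. mpoly_eval (f i))"
  by (induction I rule: infinite_finite_induct) (auto simp: mpoly_eval_zero mpoly_eval_add)

lemma mpoly_eval_single: "mpoly_eval (Poly_Mapping.single m c) = c * monomial_eval m"
  by (cases "c = 0") (simp_all add: mpoly_eval_def)

text \<open>
  Multiplication of finitely supported maps is defined by a convolution over all indices.
  Expanding the factors into single terms replaces it by a finite double sum.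
\<close>

lemma sum_of_singles:
  "p = (\<Sum>m\<in>Poly_Mapping.keys p. Poly_Mapping.single m (Poly_Mapping.lookup p m))"
  by (rule poly_mapping_eqI)
    (auto simp: lookup_sum lookup_single when_def in_keys_iff)

lemma mult_as_sum_of_singles:
  fixes p q :: "'b::monoid_add \<Rightarrow>\<^sub>0 'a::comm_ring_1"
  shows "p * q = (\<Sum>m\<in>Poly_Mapping.keys p. \<Sum>n\<in>Poly_Mapping.keys q.
    Poly_Mapping.single (m + n) (Poly_Mapping.lookup p m * Poly_Mapping.lookup q n))"
proof -
  have "p * q = (\<Sum>m\<in>Poly_Mapping.keys p. Poly_Mapping.single m (Poly_Mapping.lookup p m)) *
      (\<Sum>n\<in>Poly_Mapping.keys q. Poly_Mapping.single n (Poly_Mapping.lookup q n))"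
    by (rule arg_cong2[OF sum_of_singles sum_of_singles])
  then show ?thesis by (simp add: sum_product mult_single)
qed

lemma mpoly_eval_mult: "mpoly_eval (p * q) = mpoly_eval p * mpoly_eval q"
  unfolding mult_as_sum_of_singles mpoly_eval_sum mpoly_eval_single monomial_eval_add
  by (simp add: mpoly_eval_def sum_product ac_simps)

definition mpolys :: "'a::field set \<Rightarrow> 'a set \<Rightarrow> (('a \<Rightarrow>\<^sub>0 nat) \<Rightarrow>\<^sub>0 'a) set" where
  "mpolys K T = {p. \<forall>m\<in>Poly_Mapping.keys p. Poly_Mapping.lookup p m \<in> K \<and> Poly_Mapping.keys m \<subseteq> T}"

lemma mpolys_lookup: "is_subring K \<Longrightarrow> p \<in> mpolys K T \<Longrightarrow> Poly_Mapping.lookup p m \<in> K"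
  by (cases "m \<in> Poly_Mapping.keys p") (auto simp: mpolys_def in_keys_iff subring_zero)

lemma mpolys_keys:
  "p \<in> mpolys K T \<Longrightarrow> m \<in> Poly_Mapping.keys p \<Longrightarrow> Poly_Mapping.keys m \<subseteq> T"
  unfolding mpolys_def by blast

lemma single_in_mpolys:
  "c \<in> K \<Longrightarrow> Poly_Mapping.keys m \<subseteq> T \<Longrightarrow> Poly_Mapping.single m c \<in> mpolys K T"
  by (cases "c = 0") (auto simp: mpolys_def)

lemma mpolys_subring:
  assumes K: "is_subring K"
  shows "is_subring (mpolys K T)"
proof -
  have diff: "p - q \<in> mpolys K T" if "p \<in> mpolys K T" "q \<in> mpolys K T" for p q
  proof -
    have "Poly_Mapping.keys m \<subseteq> T" if "m \<in> Poly_Mapping.keys (p - q)" for m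
      using that \<open>p \<in> mpolys K T\<close> \<open>q \<in> mpolys K T\<close> keys_diff[of p q] mpolys_keys by blast
    moreover have "Poly_Mapping.lookup (p - q) m \<in> K" for m
      unfolding lookup_minus
      using \<open>p \<in> mpolys K T\<close> \<open>q \<in> mpolys K T\<close>
      by (auto intro: subring_diff[OF K] mpolys_lookup[OF K])
    ultimately show ?thesis unfolding mpolys_def by blast
  qed
  have zero: "0 \<in> mpolys K T" by (simp add: mpolys_def)
  have add: "p + q \<in> mpolys K T" if "p \<in> mpolys K T" "q \<in> mpolys K T" for p q
    using diff[OF that(1) diff[OF zero that(2)]] by simp
  have sum: "sum f I \<in> mpolys K T" if "\<And>i. i \<in> I \<Longrightarrow> f i \<in> mpolys K T"
    for f and I :: "('a \<Rightarrow>\<^sub>0 nat) set"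
    using that by (induction I rule: infinite_finite_induct) (auto intro: zero add)
  have mult: "p * q \<in> mpolys K T" if "p \<in> mpolys K T" "q \<in> mpolys K T" for p q
    unfolding mult_as_sum_of_singles
  proof (intro sum single_in_mpolys subring_mult[OF K] mpolys_lookup[OF K that(1)]
      mpolys_lookup[OF K that(2)])
    fix m n assume "m \<in> Poly_Mapping.keys p" "n \<in> Poly_Mapping.keys q"
    then show "Poly_Mapping.keys (m + n) \<subseteq> T"
      using keys_add[of m n] mpolys_keys that by blast
  qed
  have "1 \<in> mpolys K T"
    using single_in_mpolys[of 1 K 0 T] subring_one[OF K] by simp
  then show ?thesis using diff mult by (intro is_subringI)
qed

lemma mpoly_values_subring:
  assumes "is_subring K"
  shows "is_subring (mpoly_eval ` mpolys K T)"
proof (rule is_subringI)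
  note PK = mpolys_subring[OF assms, of T]
  have "mpoly_eval 1 = (1::'a)" using mpoly_eval_single[of 0 1] by simp
  then show "1 \<in> mpoly_eval ` mpolys K T"
    using subring_one[OF PK] by (intro image_eqI[of 1 _ 1]) simp_all
  fix x y assume "x \<in> mpoly_eval ` mpolys K T" "y \<in> mpoly_eval ` mpolys K T"
  then obtain p q where pq: "p \<in> mpolys K T" "q \<in> mpolys K T"
    and xy: "x = mpoly_eval p" "y = mpoly_eval q" by (elim imageE)
  show "x - y \<in> mpoly_eval ` mpolys K T"
    unfolding xy mpoly_eval_diff[symmetric] by (intro imageI subring_diff[OF PK] pq)
  show "x * y \<in> mpoly_eval ` mpolys K T"
    unfolding xy mpoly_eval_mult[symmetric] by (intro imageI subring_mult[OF PK] pq)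
qed

lemma field_adjoin_subset_mpoly_quotients:
  assumes K: "is_subring K"
  shows "field_adjoin K T \<subseteq> quotients (mpoly_eval ` mpolys K T)"
proof (rule field_adjoin_minimal)
  let ?B = "mpoly_eval ` mpolys K T"
  note B = mpoly_values_subring[OF K, of T]
  have "c \<in> ?B" if "c \<in> K" for c
  proof -
    have "mpoly_eval (Poly_Mapping.single 0 c) = c" by (simp add: mpoly_eval_single)
    moreover have "Poly_Mapping.single 0 c \<in> mpolys K T" using that by (intro single_in_mpolys) auto
    ultimately show ?thesis by (rule image_eqI[OF sym])
  qed
  then show "K \<subseteq> quotients ?B" using subset_quotients[OF B] by blast
  have "x \<in> ?B" if "x \<in> T" for x
  proof -
    have "mpoly_eval (Poly_Mapping.single (Poly_Mapping.single x 1) 1) = x"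
      by (simp add: mpoly_eval_single)
    moreover have "Poly_Mapping.single (Poly_Mapping.single x 1) 1 \<in> mpolys K T"
      using subring_one[OF K] that by (intro single_in_mpolys) auto
    ultimately show ?thesis by (rule image_eqI[OF sym])
  qed
  then show "T \<subseteq> quotients ?B" using subset_quotients[OF B] by blast
  show "is_subfield (quotients ?B)" by (rule quotients_subfield[OF B])
qed

section \<open>Independent elements are transcendental over the others\<close>

text \<open>
  Clearing denominators in an algebraic equation for \<open>\<theta>\<close> makes its coefficients values \<open>f i\<close>
  of polynomials in the other variables. Then the sum of the \<open>f i\<close> times the \<open>i\<close>-th powers of
  the variable for \<open>\<theta>\<close> is a relation between the elements of \<open>T\<close>, so it vanishes. As that
  variable does not occur in the \<open>f i\<close>, terms for different \<open>i\<close> cannot cancel, and each \<open>f i\<close>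
  vanishes as well.
\<close>

theorem algebraically_independent_transcendental:
  assumes K: "is_subring K" and indep: "algebraically_independent K T" and \<theta>: "\<theta> \<in> T"
  shows "\<not> algebraic_over (field_adjoin K (T - {\<theta>})) \<theta>"
proof
  let ?T = "T - {\<theta>}"
  let ?B = "mpoly_eval ` mpolys K ?T"
  assume "algebraic_over (field_adjoin K ?T) \<theta>"
  from algebraic_over_quotients_clear[OF mpoly_values_subring[OF K]
      field_adjoin_subset_mpoly_quotients[OF K] this]
  obtain p where p: "p \<in> poly_over ?B" "p \<noteq> 0" "poly p \<theta> = 0" by blast
  have "\<forall>i. \<exists>f\<in>mpolys K ?T. coeff p i = mpoly_eval f" using poly_over_coeff[OF p(1)] by blast
  then obtain f where f: "\<And>i. f i \<in> mpolys K ?T" "\<And>i. coeff p i = mpoly_eval (f i)" by metis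
  define var where "var i = Poly_Mapping.single \<theta> (i::nat)" for i
  define Q where "Q = (\<Sum>i\<le>degree p. f i * Poly_Mapping.single (var i) 1)"
  have "monomial_eval (var i) = \<theta> ^ i" for i by (cases "i = 0") (simp_all add: var_def)
  then have "mpoly_eval Q = 0"
    using p(3) by (simp add: Q_def mpoly_eval_sum mpoly_eval_mult mpoly_eval_single poly_altdef f(2))
  moreover have "Q \<in> mpolys K T"
    unfolding Q_def
  proof (intro subring_sum subring_mult mpolys_subring K single_in_mpolys subring_one[OF K])
    show "f i \<in> mpolys K T" for i using f(1)[of i] unfolding mpolys_def by blast
    show "Poly_Mapping.keys (var i) \<subseteq> T" for i using \<theta> by (simp add: var_def)
  qed
  ultimately have "Q = 0"
    using indep[unfolded algebraically_independent_def, rule_format, of Q] by (simp add: mpolys_def)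
  have "f j = 0" if j: "j \<le> degree p" for j
  proof (rule ccontr)
    assume "f j \<noteq> 0"
    then obtain m where m: "m \<in> Poly_Mapping.keys (f j)"
      by (metis keys_eq_empty ex_in_conv)
    \<comment> \<open>The monomials of the coefficients do not involve \<open>\<theta>\<close>, so the exponent of \<open>\<theta>\<close> tells
      the summands of \<open>Q\<close> apart.\<close>
    have no_var: "Poly_Mapping.lookup n \<theta> = 0" if "n \<in> Poly_Mapping.keys (f i)" for n i
      using mpolys_keys[OF f(1) that] by (auto simp: in_keys_iff)
    have sep: "n + var i = m + var j \<longleftrightarrow> i = j \<and> n = m" if "n \<in> Poly_Mapping.keys (f i)" for n i
    proof
      assume eq: "n + var i = m + var j"
      then have "Poly_Mapping.lookup (n + var i) \<theta> = Poly_Mapping.lookup (m + var j) \<theta>" by simp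
      then have "i = j" using no_var[OF that] no_var[OF m] by (simp add: var_def lookup_add)
      with eq show "i = j \<and> n = m" by simp
    qed simp
    have "f i * Poly_Mapping.single (var i) 1 =
      (\<Sum>n\<in>Poly_Mapping.keys (f i). Poly_Mapping.single (n + var i) (Poly_Mapping.lookup (f i) n))" for i
      unfolding mult_as_sum_of_singles by simp
    then have "Poly_Mapping.lookup Q (m + var j) = (\<Sum>i\<le>degree p. \<Sum>n\<in>Poly_Mapping.keys (f i).
        if n + var i = m + var j then Poly_Mapping.lookup (f i) n else 0)"
      by (simp add: Q_def lookup_sum lookup_single when_def)
    also have "\<dots> = (\<Sum>i\<le>degree p. \<Sum>n\<in>Poly_Mapping.keys (f i).
        if i = j \<and> n = m then Poly_Mapping.lookup (f i) n else 0)"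
      by (intro sum.cong refl if_cong sep)
    also have "\<dots> = (\<Sum>i\<le>degree p. if i = j then Poly_Mapping.lookup (f j) m else 0)"
      using m by (intro sum.cong) auto
    also have "\<dots> = Poly_Mapping.lookup (f j) m" using j by simp
    finally show False using \<open>Q = 0\<close> m by (simp add: in_keys_iff)
  qed
  then have "lead_coeff p = 0" by (simp add: f(2) mpoly_eval_zero)
  then show False using p(2) by simp
qed

section \<open>The cone of elements with positive leading residue\<close>

text \<open>
  The elements whose residue modulo \<open>s R\<close> is a positive rational number.
\<close>

definition positive_residues :: "'a::field_char_0 \<Rightarrow> 'a set \<Rightarrow> 'a set" where
  "positive_residues s R = {of_rat q + s * r | q r. 0 < q \<and> r \<in> R}"

lemma cone_of_iff:
  "x \<in> cone_of s R \<longleftrightarrow> x = 0 \<or> (\<exists>k::int. \<exists>u\<in>positive_residues s R. x = s powi k * u)"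
proof -
  have "(\<exists>n::int. x \<in> (s powi (- n)) *o (of_rat ` {q. 0 < q} + s *o R)) \<longleftrightarrow>
    (\<exists>k::int. \<exists>u\<in>positive_residues s R. x = s powi k * u)" (is "(\<exists>n. ?P n) \<longleftrightarrow> (\<exists>k. ?Q k)")
  proof -
    have "?P n \<longleftrightarrow> ?Q (- n)" for n
      unfolding elt_set_times_def set_plus_def positive_residues_def by blast
    then show ?thesis by (metis minus_minus)
  qed
  then show ?thesis unfolding cone_of_def by blast
qed

text \<open>
  Write \<open>U\<close> for the elements with positive rational residue. Since \<open>s\<close> is in the Jacobson
  radical, \<open>U\<close> is a multiplicative group: the inverse of \<open>q + s r\<close> exists in \<open>R\<close> and has residue
  \<open>1/q\<close>. The nonzero elements of the cone are the products of powers of \<open>s\<close> with elements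
  of \<open>U\<close>, and this settles products and inverses.

  In a sum of two of them, the lower power of \<open>s\<close> can be factored out, and the cofactor lies in \<open>U\<close>:
  its residue is that of one summand, or the sum of both residues if the exponents agree.
  So the nonzero elements are closed under addition, and they do not contain \<open>0\<close>; hence no nonzero
  element lies in the cone together with its negative. Finally, if \<open>s ^ N * x\<close> is in \<open>R\<close>, then
  \<open>x = s ^ (- N - 1) * (1 + s * (s ^ N * x)) - s ^ (- N - 1)\<close> is a difference of cone elements,
  and every element being such a difference is equivalent to directedness.
\<close>

theorem cone_of_directed_division_closed:
  fixes s :: "'a::field_char_0" and R :: "'a set"
  assumes R: "is_subring R" and rats: "\<rat> \<subseteq> R" and s: "in_radical s R" "s \<noteq> 0"
    and scaled: "\<And>x. \<exists>N. s ^ N * x \<in> R"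
  defines "P \<equiv> cone_of s R"
  shows "positive_cone P" "directed_order (cone_le P)" "1 \<in> P"
    "x \<in> P \<Longrightarrow> x \<noteq> 0 \<Longrightarrow> inverse x \<in> P"
proof -
  let ?U = "positive_residues s R"
  note R_closed = subring_add[OF R] subring_diff[OF R] subring_mult[OF R] subring_power[OF R]
    subring_minus[OF R] subring_one[OF R] subring_zero[OF R]
  have sR: "s \<in> R" using s unfolding in_radical_def by blast
  have ratR: "of_rat q \<in> R" for q using rats by auto
  have U_I: "of_rat q + s * r \<in> ?U" if "0 < q" "r \<in> R" for q r
    using that unfolding positive_residues_def by blast
  have U_E: thesis if "u \<in> ?U" "\<And>q r. 0 < q \<Longrightarrow> r \<in> R \<Longrightarrow> u = of_rat q + s * r \<Longrightarrow> thesis"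
    for u thesis using that unfolding positive_residues_def by blast
  have U_R: "u \<in> R" if "u \<in> ?U" for u
    using that by (elim U_E) (auto intro: R_closed sR ratR)
  have U_add_s: "u + s * r \<in> ?U" if "u \<in> ?U" "r \<in> R" for u r
    using that by (elim U_E) (metis U_I add.assoc distrib_left subring_add[OF R])
  have U_add: "u + v \<in> ?U" if "u \<in> ?U" "v \<in> ?U" for u v
  proof -
    from that obtain q r q' r' where
      "0 < q" "r \<in> R" "u = of_rat q + s * r" "0 < q'" "r' \<in> R" "v = of_rat q' + s * r'"
      by (metis U_E)
    then have "0 < q + q'" "r + r' \<in> R" "u + v = of_rat (q + q') + s * (r + r')"
      by (auto simp: of_rat_add algebra_simps intro: R_closed)
    then show ?thesis using U_I by simp
  qed
  have U_mult: "u * v \<in> ?U" if "u \<in> ?U" "v \<in> ?U" for u v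
  proof -
    from that obtain q r q' r' where
      uv: "0 < q" "r \<in> R" "u = of_rat q + s * r" "0 < q'" "r' \<in> R" "v = of_rat q' + s * r'"
      by (metis U_E)
    then have "u * v = of_rat (q * q') + s * (of_rat q * r' + r * v)"
      by (simp add: of_rat_mult algebra_simps)
    moreover have "of_rat q * r' + r * v \<in> R"
      using uv U_R[OF that(2)] by (intro R_closed ratR) auto
    ultimately show ?thesis using U_I uv(1,4) by simp
  qed
  have U_unit: "u \<noteq> 0 \<and> inverse u \<in> ?U" if "u \<in> ?U" for u
  proof -
    from that obtain q r where u: "0 < q" "r \<in> R" "u = of_rat q + s * r" by (rule U_E)
    have q: "(of_rat q :: 'a) \<noteq> 0" using u(1) by simp
    define r' where "r' = of_rat (inverse q) * r"
    have r': "r' \<in> R" unfolding r'_def by (intro R_closed ratR u)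
    have u': "u = of_rat q * (1 + s * r')"
      using q by (simp add: u(3) r'_def of_rat_inverse distrib_left flip: mult.assoc)
    from s(1) r' have unit: "1 + s * r' \<noteq> 0" "inverse (1 + s * r') \<in> R"
      unfolding in_radical_def by auto
    \<comment> \<open>With \<open>w = 1 + s * r'\<close>, the identity \<open>1/w = 1 - s * r' * (1/w)\<close> exhibits the residue of \<open>1/w\<close>.\<close>
    define t where "t = - (of_rat (inverse q) * r' * inverse (1 + s * r'))"
    have "t \<in> R" unfolding t_def by (intro R_closed ratR r' unit(2))
    moreover have "inverse u = of_rat (inverse q) + s * t"
    proof -
      have "inverse (1 + s * r') * (1 + s * r') = 1" using unit(1) by simp
      then have "inverse (1 + s * r') = 1 - s * r' * inverse (1 + s * r')"
        by (simp add: algebra_simps)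
      then have "of_rat (inverse q) * inverse (1 + s * r') =
          of_rat (inverse q) * (1 - s * r' * inverse (1 + s * r'))" by simp
      then show ?thesis
        unfolding u' t_def inverse_mult_distrib of_rat_inverse by (simp add: algebra_simps)
    qed
    ultimately show ?thesis using U_I[of "inverse q" t] u(1) u' q unit(1) by simp
  qed
  have one_U: "1 \<in> ?U" using U_I[of 1 0] R_closed by simp
  have P_I: "s powi k * u \<in> P" if "u \<in> ?U" for k u
    using that unfolding P_def cone_of_iff by blast
  have P_E: "\<exists>k u. u \<in> ?U \<and> x = s powi k * u" if "x \<in> P" "x \<noteq> 0" for x
    using that unfolding P_def cone_of_iff by blast
  have zero_P: "0 \<in> P" unfolding P_def cone_of_iff by blast
  have sum_le: "\<exists>m. \<exists>w\<in>?U. s powi k * u + s powi l * v = s powi m * w"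
    if "u \<in> ?U" "v \<in> ?U" "k \<le> l" for k l u v
  proof -
    define d where "d = nat (l - k)"
    have "s powi l = s powi (k + int d)" using that by (simp add: d_def)
    also have "\<dots> = s powi k * s ^ d" using s(2) by (simp add: power_int_add)
    finally have eq: "s powi k * u + s powi l * v = s powi k * (u + s ^ d * v)"
      by (simp add: algebra_simps)
    have "u + s ^ d * v \<in> ?U"
    proof (cases d)
      case 0
      then show ?thesis using U_add that by simp
    next
      case (Suc e)
      have "u + s * (s ^ e * v) \<in> ?U"
        by (intro U_add_s R_closed sR U_R that)
      then show ?thesis by (simp add: Suc mult.assoc)
    qed
    with eq show ?thesis by blast
  qed
  have sum: "\<exists>m. \<exists>w\<in>?U. s powi k * u + s powi l * v = s powi m * w"
    if "u \<in> ?U" "v \<in> ?U" for k l u v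
  proof (cases "k \<le> l")
    case True
    then show ?thesis using sum_le that by blast
  next
    case False
    then show ?thesis using sum_le[of v u l k] that by (simp add: add.commute)
  qed
  have P_add: "x + y \<in> P" if "x \<in> P" "y \<in> P" for x y
  proof (cases "x = 0 \<or> y = 0")
    case True
    with that show ?thesis by auto
  next
    case False
    with that obtain k l u v where uv: "u \<in> ?U" "v \<in> ?U" "x = s powi k * u" "y = s powi l * v"
      using P_E[of x] P_E[of y] by blast
    obtain m w where "w \<in> ?U" "x + y = s powi m * w" using sum[OF uv(1,2)] uv by blast
    then show ?thesis using P_I by simp
  qed
  have P_mult: "x * y \<in> P" if "x \<in> P" "y \<in> P" for x y
  proof -
    have mult: "s powi k * u * (s powi l * v) \<in> P" if "u \<in> ?U" "v \<in> ?U" for k l u v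
    proof -
      have "s powi k * u * (s powi l * v) = s powi (k + l) * (u * v)"
        using s(2) by (simp add: power_int_add)
      then show ?thesis using P_I[OF U_mult[OF that]] by metis
    qed
    show ?thesis
    proof (cases "x = 0 \<or> y = 0")
      case True
      then show ?thesis using zero_P by auto
    next
      case False
      with that obtain k l u v where "u \<in> ?U" "v \<in> ?U" "x = s powi k * u" "y = s powi l * v"
        using P_E[of x] P_E[of y] by blast
      with mult show ?thesis by simp
    qed
  qed
  have P_proper: "x = 0" if "x \<in> P" "- x \<in> P" for x
  proof (rule ccontr)
    assume "x \<noteq> 0"
    then have "- x \<noteq> 0" by simp
    with \<open>x \<noteq> 0\<close> that
    obtain k l u v where uv: "u \<in> ?U" "v \<in> ?U" "x = s powi k * u" "- x = s powi l * v"
      using P_E[of x] P_E[of "- x"] by blast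
    then obtain m w where w: "w \<in> ?U" "x + - x = s powi m * w" using sum[OF uv(1,2)] by metis
    then have "w = 0" using s(2) by simp
    then show False using U_unit w(1) by blast
  qed
  show "positive_cone P" unfolding positive_cone_def
  proof (intro conjI)
    show "P + P \<subseteq> P" "P * P \<subseteq> P"
      using P_add P_mult by (auto elim!: set_plus_elim set_times_elim)
    have "x = 0" if "x \<in> P" "x \<in> uminus ` P" for x using that P_proper by auto
    then show "P \<inter> uminus ` P = {0}" 
      using zero_P by (auto intro: image_eqI[of 0 uminus 0])
  qed
  show "1 \<in> P" using P_I[OF one_U, of 0] by simp
  show "inverse x \<in> P" if "x \<in> P" "x \<noteq> 0" for x
  proof -
    from that obtain k u where ku: "u \<in> ?U" "x = s powi k * u" using P_E[of x] by blast
    then have "inverse x = s powi (- k) * inverse u" by (simp add: power_int_minus)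
    then show ?thesis using P_I U_unit[OF ku(1)] by simp
  qed
  have generating: "\<exists>a\<in>P. \<exists>b\<in>P. x = a - b" for x
  proof -
    obtain N where N: "s ^ N * x \<in> R" using scaled by blast
    define k where "k = - int (Suc N)"
    have pow: "s powi k * (s * s ^ N) = 1"
      unfolding k_def power_int_minus power_int_of_nat power_Suc[symmetric]
      using s(2) by (intro left_inverse power_not_zero)
    have "1 + s * (s ^ N * x) \<in> ?U" using U_add_s one_U N by blast
    moreover have "x = s powi k * (1 + s * (s ^ N * x)) - s powi k * 1"
    proof -
      have "s powi k * (1 + s * (s ^ N * x)) - s powi k * 1 = s powi k * (s * s ^ N) * x"
        by (simp add: algebra_simps)
      then show ?thesis using pow by simp
    qed
    ultimately show ?thesis using P_I[of _ k] one_U by blast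
  qed
  show "directed_order (cone_le P)"
    unfolding directed_order_def cone_le_def
  proof (intro allI conjI)
    fix x y
    obtain a b c d where ab: "a \<in> P" "b \<in> P" "x = a - b" "c \<in> P" "d \<in> P" "y = c - d"
      using generating[of x] generating[of y] by blast
    have "(a + c) - x = c + b" "(a + c) - y = a + d" using ab by simp_all
    then show "\<exists>z. z - x \<in> P \<and> z - y \<in> P" using P_add ab by (intro exI[of _ "a + c"]) simp
    have "x - - (b + d) = a + d" "y - - (b + d) = c + b" using ab by simp_all
    then show "\<exists>z. x - z \<in> P \<and> y - z \<in> P" using P_add ab by (intro exI[of _ "- (b + d)"]) simp
  qed
qed

lemma rat_subring: "is_subring (\<rat> :: 'a::field_char_0 set)"
  by (auto simp: is_subring_def)

theorem corollary2p6:
  fixes T :: "'a::field_char_0 set" and \<theta> s :: 'a and k0 R P :: "'a set"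
  assumes trdeg_pos: "((BNF_Cardinal_Arithmetic.czero :: 'a rel), trdeg (\<rat> :: 'a set)) \<in> ordLess"
    and basis: "transcendence_basis \<rat> T"
    and theta: "\<theta> \<in> T"
    and k0: "k0 = field_adjoin \<rat> (T - {\<theta>})"
    and s: "s = inverse \<theta>"
    and R: "R = integral_closure (localization_at k0 s)"
    and P: "P = cone_of s R"
  shows "positive_cone P \<and> directed_order (cone_le P) \<and>
         1 \<in> P \<and> (\<forall>x\<in>P. x \<noteq> 0 \<longrightarrow> inverse x \<in> P)"
proof -
  define A where "A = localization_at k0 s"
  have k0_field: "is_subfield k0" unfolding k0 by (rule field_adjoin_subfield)
  note k0_ring = subfield_subring[OF k0_field]
  have "\<not> algebraic_over k0 \<theta>"
    unfolding k0
    by (rule algebraically_independent_transcendental[OF rat_subring _ theta])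
      (use basis in \<open>simp add: transcendence_basis_def\<close>)
  then have trans: "\<not> algebraic_over k0 s"
    using algebraic_over_inverse[OF k0_ring, of s] unfolding s inverse_inverse_eq by blast
  note A = localization_at_subring[OF k0_field trans, folded A_def]
  note k0_A = constants_in_localization[OF k0_field trans, folded A_def]
  note rad = in_radical_localization[OF k0_field trans, folded A_def]
  have "\<rat> \<subseteq> k0" and T_k0: "T - {\<theta>} \<subseteq> k0" unfolding k0 by (rule subset_field_adjoin)+
  with k0_A have rats: "\<rat> \<subseteq> A" by blast
  note s_nz = transcendental_nonzero[OF k0_field trans]
  have adjoin: "field_adjoin \<rat> T \<subseteq> quotients A"
  proof (rule field_adjoin_minimal)
    note AQ = subset_quotients[OF A]
    show "\<rat> \<subseteq> quotients A" using rats AQ by blast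
    have "\<theta> = 1 / s" by (simp add: s divide_inverse)
    then have "\<theta> \<in> quotients A"
      using rad s_nz subring_one[OF A] quotientsI[of 1 A s] by (simp add: in_radical_def)
    moreover have "T - {\<theta>} \<subseteq> quotients A"
      using k0_A AQ T_k0 by blast
    ultimately show "T \<subseteq> quotients A" by blast
    show "is_subfield (quotients A)" by (rule quotients_subfield[OF A])
  qed
  have scaled: "\<exists>N. s ^ N * x \<in> R" for x
    unfolding R A_def[symmetric]
  proof (rule power_multiple_integral[OF A adjoin])
    show "algebraic_over (field_adjoin \<rat> T) x" using basis by (simp add: transcendence_basis_def)
    show "\<exists>N. s ^ N * inverse a \<in> A" if "a \<in> A" "a \<noteq> 0" for a
      using power_over_nonzero_in_localization[OF k0_field trans, folded A_def] that by blast
  qed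
  have R_ring: "is_subring R" unfolding R A_def[symmetric] by (rule integral_closure_subring[OF A])
  have R_rats: "\<rat> \<subseteq> R" unfolding R A_def[symmetric] using rats subset_integral_closure[OF A] by blast
  have R_rad: "in_radical s R"
    unfolding R A_def[symmetric] by (rule in_radical_integral_closure[OF A rad])
  note cone = cone_of_directed_division_closed[OF R_ring R_rats R_rad s_nz scaled, folded P]
  from cone(1-3) show ?thesis by (intro conjI ballI impI cone(4))
qed

end
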